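(* Let $n\ge 1$ and let $\pi_1,\pi_2$ be permutations of $[n]=\{1,\dots,n\}$. Then $$\rho_{\mathrm{PT}}(\pi_1,\pi_2)\le \rho_{\mathrm{EMD}}(\pi_1,\pi_2)\le 2\,\rho_{\mathrm{PT}}(\pi_1,\pi_2),$$ where $\rho_{\mathrm{PT}}$ is the planar tau distance and $\rho_{\mathrm{EMD}}$ is the earth mover's distance.
   Context: A permutation $\pi$ of length $n$ is a bijection $[n]\to[n]$. A permutation $\sigma$ of $[n]$ is obtained from $\pi$ by a planar simple transposition if there is an integer $1\le i\le n-1$ such that either $\sigma$ equals $\pi$ except that $\sigma(i)=\pi(i+1)$ and $\sigma(i+1)=\pi(i)$, or $\sigma^{-1}$ equals $\pi^{-1}$ except that $\sigma^{-1}(i)=\pi^{-1}(i+1)$ and $\sigma^{-1}(i+1)=\pi^{-1}(i)$. The planar tau distance $\rho_{\mathrm{PT}}(\pi_1,\pi_2)$ is $\frac{1}{\binom n2}$ times the minimum number of planar simple transpositions needed to transform $\pi_1$ into $\pi_2$. The earth mover's distance is $$\rho_{\mathrm{EMD}}(\pi_1,\pi_2)=\frac{1}{\binom n2}\min_{\theta}\sum_{i=1}^n\bigl(|i-\theta(i)|+|\pi_1(i)-\pi_2(\theta(i))|\bigr),$$ the minimum being over all bijections $\theta:[n]\to[n]$. For $n=1$ both distances are $0$ by convention. *)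

theory Defs
  imports Complex_Main "HOL-Combinatorics.Permutations"
begin

text \<open>
  A permutation of \<open>[n]\<close> is a function \<open>p\<close> with \<open>p permutes {1..n}\<close>, i.e. a bijection of
  \<open>{1..n}\<close> extended by the identity to a bijection of all naturals; \<open>inv p\<close> is therefore the
  inverse permutation.
\<close>

text \<open>
  The first disjunct swaps the values at two adjacent positions, the second one swaps the
  positions of two adjacent values.
\<close>

definition planar_simple_transposition :: "nat \<Rightarrow> (nat \<Rightarrow> nat) \<Rightarrow> (nat \<Rightarrow> nat) \<Rightarrow> bool" where
  "planar_simple_transposition n p s \<longleftrightarrow>
     p permutes {1..n} \<and> s permutes {1..n} \<and>
     (\<exists>i. 1 \<le> i \<and> i \<le> n - 1 \<and>
        (s = p(i := p (i + 1), i + 1 := p i) \<or>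
         inv s = (inv p)(i := inv p (i + 1), i + 1 := inv p i)))"

text \<open>
  Any two permutations of \<open>{1..n}\<close> are connected by planar simple transpositions (those of
  the first kind suffice), so for permutations the \<open>LEAST\<close> below is always attained.
\<close>

definition planar_steps :: "nat \<Rightarrow> (nat \<Rightarrow> nat) \<Rightarrow> (nat \<Rightarrow> nat) \<Rightarrow> nat" where
  "planar_steps n p1 p2 = (LEAST k. (planar_simple_transposition n ^^ k) p1 p2)"

definition planar_tau_dist :: "nat \<Rightarrow> (nat \<Rightarrow> nat) \<Rightarrow> (nat \<Rightarrow> nat) \<Rightarrow> real" where
  "planar_tau_dist n p1 p2 =
     (if n = 1 then 0 else 1 / real (n choose 2) * real (planar_steps n p1 p2))"

definition emd_cost :: "nat \<Rightarrow> (nat \<Rightarrow> nat) \<Rightarrow> (nat \<Rightarrow> nat) \<Rightarrow> (nat \<Rightarrow> nat) \<Rightarrow> int" where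
  "emd_cost n p1 p2 \<theta> =
     (\<Sum>i\<in>{1..n}. \<bar>int i - int (\<theta> i)\<bar> + \<bar>int (p1 i) - int (p2 (\<theta> i))\<bar>)"

definition earth_mover_dist :: "nat \<Rightarrow> (nat \<Rightarrow> nat) \<Rightarrow> (nat \<Rightarrow> nat) \<Rightarrow> real" where
  "earth_mover_dist n p1 p2 =
     (if n = 1 then 0
      else 1 / real (n choose 2) *
           real_of_int (Min (emd_cost n p1 p2 ` {\<theta>. \<theta> permutes {1..n}})))"

end

theory Submission
  imports Defs
begin

text \<open>
  Planar simple transpositions are multiplications by adjacent transpositions on the right or on the
  left, so \<open>k\<close> of them lead from \<open>p\<^sub>1\<close> to \<open>p\<^sub>2\<close> iff \<open>p\<^sub>2 = \<beta> \<circ> p\<^sub>1 \<circ> \<theta>\<inverse>\<close> where \<open>\<theta>\<close> and \<open>\<beta>\<close> are products of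
  \<open>k\<close> adjacent transpositions in total. The earth mover's cost of \<open>\<theta>\<close> is the sum of the displacements
  \<open>\<Sum>\<^sub>i \<bar>i - \<theta> i\<bar>\<close> and \<open>\<Sum>\<^sub>i \<bar>i - \<beta> i\<bar>\<close>. It remains to compare displacement and word length, following
  Diaconis and Graham: each adjacent transposition contributes at most \<open>2\<close> to the displacement, and
  conversely every permutation can be sorted by swaps of positions \<open>i < j\<close> each of which lowers the
  displacement by \<open>2 (j - i)\<close> while costing \<open>2 (j - i) - 1\<close> adjacent transpositions.
\<close>

section \<open>Displacement (Spearman's footrule)\<close>

definition displacement :: "nat \<Rightarrow> (nat \<Rightarrow> nat) \<Rightarrow> int" where
  "displacement n \<sigma> = (\<Sum>i\<in>{1..n}. \<bar>int i - int (\<sigma> i)\<bar>)"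

lemma displacement_nonneg: "0 \<le> displacement n \<sigma>"
  by (simp add: displacement_def sum_nonneg)

lemma displacement_inv:
  assumes "\<sigma> permutes {1..n}"
  shows "displacement n (inv \<sigma>) = displacement n \<sigma>"
proof -
  have "displacement n (inv \<sigma>) = (\<Sum>i\<in>{1..n}. \<bar>int (\<sigma> i) - int (inv \<sigma> (\<sigma> i))\<bar>)"
    unfolding displacement_def by (subst sum.permute[OF assms]) (simp add: o_def)
  then show ?thesis
    by (simp add: displacement_def permutes_inverses[OF assms] abs_minus_commute)
qed

lemma displacement_adjacent_transpose:
  assumes "1 \<le> i" "i < n"
  shows "displacement n (transpose i (Suc i)) = 2"
proof -
  have "displacement n (transpose i (Suc i))
      = (\<Sum>k\<in>{i, Suc i}. \<bar>int k - int (transpose i (Suc i) k)\<bar>)"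
    unfolding displacement_def
    by (rule sum.mono_neutral_right) (use assms in \<open>auto simp: transpose_def\<close>)
  then show ?thesis by simp
qed

text \<open>Only the terms at \<open>i\<close> and \<open>j\<close> change. As
  \<open>\<sigma> j \<le> i < j \<le> \<sigma> i\<close>, both images lie beyond the opposite point,
  so exchanging them shortens each of the two moves by \<open>j - i\<close>.\<close>

lemma displacement_comp_transpose:
  assumes "1 \<le> i" "i < j" "j \<le> n" "j \<le> \<sigma> i" "\<sigma> j \<le> i"
  shows "displacement n (\<sigma> \<circ> transpose i j) = displacement n \<sigma> - 2 * (int j - int i)"
proof -
  have split: "displacement n \<tau> = \<bar>int i - int (\<tau> i)\<bar> + \<bar>int j - int (\<tau> j)\<bar>
      + (\<Sum>k\<in>{1..n} - {i, j}. \<bar>int k - int (\<tau> k)\<bar>)" for \<tau>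
  proof -
    have "displacement n \<tau> = (\<Sum>k\<in>{i, j}. \<bar>int k - int (\<tau> k)\<bar>)
        + (\<Sum>k\<in>{1..n} - {i, j}. \<bar>int k - int (\<tau> k)\<bar>)"
      unfolding displacement_def
      by (subst sum.subset_diff[of "{i, j}"]) (use assms in auto)
    then show ?thesis using assms by simp
  qed
  have "(\<Sum>k\<in>{1..n} - {i, j}. \<bar>int k - int ((\<sigma> \<circ> transpose i j) k)\<bar>)
      = (\<Sum>k\<in>{1..n} - {i, j}. \<bar>int k - int (\<sigma> k)\<bar>)"
    by (rule sum.cong) (auto simp: transpose_def)
  then show ?thesis
    using assms by (simp add: split[of \<sigma>] split[of "\<sigma> \<circ> transpose i j"])
qed

text \<open>
  Let \<open>j\<close> be the least point moved down and \<open>i\<close> the last point before \<open>j\<close> that is moved up. All points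
  strictly between are fixed, so the images of \<open>i\<close> and \<open>j\<close> avoid that gap.
\<close>

lemma permutes_ex_crossing:
  fixes \<sigma> :: "nat \<Rightarrow> nat"
  assumes perm: "\<sigma> permutes {1..n}" and "\<sigma> \<noteq> id"
  obtains i j where "1 \<le> i" "i < j" "j \<le> n" "j \<le> \<sigma> i" "\<sigma> j \<le> i"
proof -
  have inj: "x = y" if "\<sigma> x = \<sigma> y" for x y
    using permutes_inj[OF perm] that by (auto dest: injD)
  have fixed: "\<sigma> x = x" if "x \<notin> {1..n}" for x
    using perm that by (auto simp: permutes_def)
  have "\<exists>j. \<sigma> j < j"
  proof (rule ccontr)
    assume "\<nexists>j. \<sigma> j < j"
    then have "\<forall>x\<in>{1..n}. x \<le> \<sigma> x" by (simp add: not_less)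
    then have "\<sigma> = id" by (rule permutes_natset_ge[OF perm])
    then show False using \<open>\<sigma> \<noteq> id\<close> by simp
  qed
  define j where "j = (LEAST j. \<sigma> j < j)"
  have j: "\<sigma> j < j"
    unfolding j_def using \<open>\<exists>j. \<sigma> j < j\<close> by (rule LeastI_ex)
  have up: "k \<le> \<sigma> k" if "k < j" for k
    using not_less_Least[of k "\<lambda>j. \<sigma> j < j"] that unfolding j_def by simp
  \<comment> \<open>The witness is \<open>\<sigma> j\<close>: it lies below \<open>j\<close>, so it
    is not moved down, and if it were fixed then injectivity would give
    \<open>\<sigma> j = j\<close>.\<close>
  have ex: "\<exists>k<j. \<sigma> k > k"
    using inj[of "\<sigma> j" j] up[of "\<sigma> j"] j by (metis le_neq_implies_less nat_neq_iff)
  define i where "i = (GREATEST k. k < j \<and> \<sigma> k > k)"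
  have i: "i < j \<and> \<sigma> i > i"
    unfolding i_def by (rule GreatestI_ex_nat[where b = j]) (use ex in auto)
  have mid: "\<sigma> k = k" if "i < k" "k < j" for k
  proof -
    have "\<not> \<sigma> k > k"
    proof
      assume "\<sigma> k > k"
      then have "k \<le> i"
        unfolding i_def by (intro Greatest_le_nat[where b = j]) (use that in auto)
      then show False using that by simp
    qed
    then show ?thesis using up[OF that(2)] by simp
  qed
  have "j \<le> \<sigma> i"
    using mid[of "\<sigma> i"] inj[of "\<sigma> i" i] i by (metis nat_neq_iff not_le)
  moreover have "\<sigma> j \<le> i"
    using mid[of "\<sigma> j"] inj[of "\<sigma> j" j] j by (metis nat_neq_iff not_le)
  moreover have "1 \<le> i" "j \<le> n"
    using fixed[of i] fixed[of j] i j by fastforce+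
  ultimately show ?thesis using that i by blast
qed

section \<open>Planar transpositions as multiplications\<close>

lemma adjacent_transpose_permutes:
  assumes "1 \<le> i" "i < n"
  shows "transpose i (Suc i) permutes {1..n}"
  using assms by (intro permutes_swap_id) auto

lemma fun_upd_adjacent_eq: "p(i := p (i + 1), i + 1 := p i) = p \<circ> transpose i (Suc i)"
  by (auto simp: fun_eq_iff transpose_def)

text \<open>Updating \<open>p\<close> multiplies it by the adjacent transposition on the right. The
  same update of \<open>inv p\<close> becomes, after inverting, a multiplication of \<open>p\<close>
  on the left.\<close>

lemma planar_simple_transposition_iff:
  assumes p: "p permutes {1..n}"
  shows "planar_simple_transposition n p s \<longleftrightarrow>
    (\<exists>i. 1 \<le> i \<and> i < n \<and> (s = p \<circ> transpose i (Suc i) \<or> s = transpose i (Suc i) \<circ> p))"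
proof -
  have left: "inv s = inv p \<circ> transpose i (Suc i) \<longleftrightarrow> s = transpose i (Suc i) \<circ> p"
    if s: "s permutes {1..n}" for i
  proof
    assume "inv s = inv p \<circ> transpose i (Suc i)"
    then have "inv (inv s) = inv (inv p \<circ> transpose i (Suc i))" by simp
    then show "s = transpose i (Suc i) \<circ> p"
      by (simp add: inv_inv_eq permutes_bij[OF p] permutes_bij[OF s] o_inv_distrib bij_imp_bij_inv)
  qed (simp add: o_inv_distrib permutes_bij[OF p])
  have perm: "s permutes {1..n}"
    if "1 \<le> i" "i < n" "s = p \<circ> transpose i (Suc i) \<or> s = transpose i (Suc i) \<circ> p" for i
    using that(3) permutes_compose adjacent_transpose_permutes[OF that(1,2)] p by blast
  have range: "1 \<le> i \<and> i \<le> n - 1 \<longleftrightarrow> 1 \<le> i \<and> i < n" for i by auto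
  show ?thesis
    unfolding planar_simple_transposition_def fun_upd_adjacent_eq
    using p left perm range by blast
qed

lemma planar_simple_transposition_permutes:
  assumes "planar_simple_transposition n p s"
  shows "p permutes {1..n}" "s permutes {1..n}"
  using assms by (auto simp: planar_simple_transposition_def)

lemma planar_simple_transposition_inv:
  assumes "planar_simple_transposition n p s"
  shows "planar_simple_transposition n (inv p) (inv s)"
proof -
  note perms = planar_simple_transposition_permutes[OF assms]
  show ?thesis
    using assms perms unfolding planar_simple_transposition_def
    by (auto simp: inv_inv_eq permutes_bij permutes_inv)
qed

section \<open>Chains no longer than the displacement\<close>

lemma relpowp_planar_inv:
  assumes "(planar_simple_transposition n ^^ k) p s"
  shows "(planar_simple_transposition n ^^ k) (inv p) (inv s)"
  using assms
proof (induction k arbitrary: s)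
  case (Suc k)
  then show ?case by (metis planar_simple_transposition_inv relpowp_Suc_E relpowp_Suc_I)
qed simp

lemma relpowp_add_I:
  assumes "(R ^^ k) x y" "(R ^^ l) y z"
  shows "(R ^^ (k + l)) x z"
  using assms by (auto simp: relpowp_add)

text \<open>Transposing \<open>i\<close> and \<open>j + 1\<close> is transposing \<open>i\<close> and \<open>j\<close> conjugated by an adjacent transposition.\<close>

lemma relpowp_planar_transpose:
  assumes "p permutes {1..n}" "1 \<le> i" "i < j" "j \<le> n"
  shows "(planar_simple_transposition n ^^ (2 * (j - i) - 1)) p (p \<circ> transpose i j)"
proof -
  \<comment> \<open>Writing \<open>j = i + d + 1\<close> removes the truncated subtraction. The
    induction needs an arbitrary \<open>q\<close>, since its hypothesis is applied to
    \<open>q \<circ> ?t\<close>.\<close>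
  have "(planar_simple_transposition n ^^ (2 * d + 1)) q (q \<circ> transpose i (Suc (i + d)))"
    if "q permutes {1..n}" "Suc (i + d) \<le> n" for q d
    using that
  proof (induction d arbitrary: q)
    case 0
    then have "planar_simple_transposition n q (q \<circ> transpose i (Suc i))"
      using \<open>1 \<le> i\<close> by (auto simp: planar_simple_transposition_iff)
    then show ?case by (simp add: eq_OO o_def)
  next
    case (Suc d)
    let ?t = "transpose (Suc (i + d)) (Suc (Suc (i + d)))"
    let ?u = "transpose i (Suc (i + d))"
    let ?P = "planar_simple_transposition n"
    have t: "?t permutes {1..n}" and u: "?u permutes {1..n}"
      using Suc.prems \<open>1 \<le> i\<close> by (auto intro!: permutes_swap_id)
    have step: "?P r (r \<circ> ?t)" if "r permutes {1..n}" for r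
      using that Suc.prems \<open>1 \<le> i\<close>
      by (auto simp: planar_simple_transposition_iff intro!: exI[of _ "Suc (i + d)"])
    have qt: "q \<circ> ?t permutes {1..n}"
      using Suc.prems(1) t by (rule permutes_compose[rotated])
    have "(?P ^^ (2 * d + 1)) (q \<circ> ?t) (q \<circ> ?t \<circ> ?u)"
      using Suc.prems by (intro Suc.IH qt) auto
    moreover have "?P (q \<circ> ?t \<circ> ?u) (q \<circ> ?t \<circ> ?u \<circ> ?t)"
      by (intro step permutes_compose[OF u] qt)
    ultimately have "(?P ^^ Suc (Suc (2 * d + 1))) q (q \<circ> ?t \<circ> ?u \<circ> ?t)"
      by (meson step[OF Suc.prems(1)] relpowp_Suc_I relpowp_Suc_I2)
    moreover have "q \<circ> ?t \<circ> ?u \<circ> ?t = q \<circ> transpose i (Suc (i + Suc d))"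
      by (auto simp: fun_eq_iff transpose_def)
    ultimately show ?case by (simp add: o_def)
  qed
  from this[of p "j - i - 1"] assms show ?thesis
    by (simp add: Suc_diff_Suc mult_2 numeral_2_eq_2)
qed

text \<open>By induction on the displacement, a permutation \<open>?\<tau>\<close> closer to the
  identity gives a chain to \<open>p \<circ> ?\<tau>\<close>; transposing the crossing pair again
  leads on to \<open>p \<circ> \<sigma>\<close>.\<close>

lemma relpowp_planar_comp_right:
  assumes "p permutes {1..n}" "\<sigma> permutes {1..n}"
  obtains k where "int k \<le> displacement n \<sigma>" "(planar_simple_transposition n ^^ k) p (p \<circ> \<sigma>)"
proof -
  have "\<exists>k. int k \<le> displacement n \<sigma> \<and> (planar_simple_transposition n ^^ k) p (p \<circ> \<sigma>)"
    using assms(2)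
  proof (induction "nat (displacement n \<sigma>)" arbitrary: \<sigma> rule: less_induct)
    case less
    show ?case
    proof (cases "\<sigma> = id")
      case True
      then show ?thesis by (intro exI[of _ 0]) (simp add: displacement_nonneg)
    next
      case False
      obtain i j where ij: "1 \<le> i" "i < j" "j \<le> n" "j \<le> \<sigma> i" "\<sigma> j \<le> i"
        using permutes_ex_crossing[OF less.prems False] by blast
      let ?\<tau> = "\<sigma> \<circ> transpose i j"
      have \<tau>: "?\<tau> permutes {1..n}"
        using ij less.prems by (intro permutes_compose permutes_swap_id) auto
      have disp: "displacement n ?\<tau> = displacement n \<sigma> - 2 * (int j - int i)"
        by (rule displacement_comp_transpose[OF ij])
      have "nat (displacement n ?\<tau>) < nat (displacement n \<sigma>)"
        using ij(2) disp displacement_nonneg[of n ?\<tau>] by simp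
      then obtain k where k: "int k \<le> displacement n ?\<tau>"
          "(planar_simple_transposition n ^^ k) p (p \<circ> ?\<tau>)"
        using less.hyps \<tau> by blast
      have "(planar_simple_transposition n ^^ (2 * (j - i) - 1)) (p \<circ> ?\<tau>) (p \<circ> ?\<tau> \<circ> transpose i j)"
        using ij permutes_compose[OF \<tau> assms(1)] by (intro relpowp_planar_transpose) auto
      moreover have "p \<circ> ?\<tau> \<circ> transpose i j = p \<circ> \<sigma>"
        by (simp add: comp_assoc)
      ultimately have "(planar_simple_transposition n ^^ (k + (2 * (j - i) - 1))) p (p \<circ> \<sigma>)"
        using relpowp_add_I[OF k(2)] by simp
      moreover have "int (k + (2 * (j - i) - 1)) \<le> displacement n \<sigma>"
        using k(1) disp ij(2) by (simp add: of_nat_diff)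
      ultimately show ?thesis by blast
    qed
  qed
  then show ?thesis using that by blast
qed

text \<open>Inversion exchanges the two sides and preserves both chain length and displacement, so
  the right-hand version applies to the inverses.\<close>

lemma relpowp_planar_comp_left:
  assumes p: "p permutes {1..n}" and \<sigma>: "\<sigma> permutes {1..n}"
  obtains k where "int k \<le> displacement n \<sigma>" "(planar_simple_transposition n ^^ k) p (\<sigma> \<circ> p)"
proof -
  obtain k where k: "int k \<le> displacement n (inv \<sigma>)"
      "(planar_simple_transposition n ^^ k) (inv p) (inv p \<circ> inv \<sigma>)"
    using permutes_inv[OF p] permutes_inv[OF \<sigma>] by (rule relpowp_planar_comp_right)
  have "inv (inv p \<circ> inv \<sigma>) = \<sigma> \<circ> p"
    using p \<sigma> by (simp add: o_inv_distrib bij_imp_bij_inv permutes_bij inv_inv_eq)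
  with relpowp_planar_inv[OF k(2)] have "(planar_simple_transposition n ^^ k) p (\<sigma> \<circ> p)"
    using p by (simp add: inv_inv_eq permutes_bij)
  with k(1) show ?thesis
    using that by (simp add: displacement_inv[OF \<sigma>])
qed

section \<open>Earth mover's cost against chain length\<close>

lemma emd_cost_eq_displacement:
  assumes p1: "p1 permutes {1..n}"
  shows "emd_cost n p1 p2 \<theta> = displacement n \<theta> + displacement n (p2 \<circ> \<theta> \<circ> inv p1)"
proof -
  \<comment> \<open>Summing over the values \<open>p1 i\<close> instead of the positions
    \<open>i\<close> turns the vertical part of the cost into a displacement.\<close>
  have "displacement n (p2 \<circ> \<theta> \<circ> inv p1) = (\<Sum>i\<in>{1..n}. \<bar>int (p1 i) - int (p2 (\<theta> i))\<bar>)"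
    unfolding displacement_def
    by (subst sum.permute[OF p1]) (simp add: o_def permutes_inverses[OF p1])
  then show ?thesis
    by (simp add: emd_cost_def displacement_def sum.distrib)
qed

text \<open>Once the second cost is reindexed along \<open>\<theta>\<close>, the triangle inequality
  holds term by term in both coordinates.\<close>

lemma emd_cost_triangle:
  assumes \<theta>: "\<theta> permutes {1..n}"
  shows "emd_cost n p1 p3 (\<eta> \<circ> \<theta>) \<le> emd_cost n p1 p2 \<theta> + emd_cost n p2 p3 \<eta>"
proof -
  have "emd_cost n p2 p3 \<eta>
      = (\<Sum>i\<in>{1..n}. \<bar>int (\<theta> i) - int (\<eta> (\<theta> i))\<bar> + \<bar>int (p2 (\<theta> i)) - int (p3 (\<eta> (\<theta> i)))\<bar>)"
    unfolding emd_cost_def by (subst sum.permute[OF \<theta>]) (simp add: o_def)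
  then show ?thesis
    unfolding emd_cost_def by (simp add: sum.distrib[symmetric] del: sum.distrib) (rule sum_mono, simp)
qed

text \<open>For a swap of positions, matching by that swap leaves all values in place; for a swap of
  values, the identity leaves all positions in place. The other coordinate costs 2.\<close>

lemma planar_simple_transposition_emd_cost:
  assumes "planar_simple_transposition n p s"
  obtains \<theta> where "\<theta> permutes {1..n}" "emd_cost n p s \<theta> = 2"
proof -
  have p: "p permutes {1..n}"
    using assms by (rule planar_simple_transposition_permutes)
  obtain i where i: "1 \<le> i" "i < n"
    and s: "s = p \<circ> transpose i (Suc i) \<or> s = transpose i (Suc i) \<circ> p"
    using assms p by (auto simp: planar_simple_transposition_iff)
  have id: "displacement n id = 0" by (simp add: displacement_def)
  note disp = displacement_adjacent_transpose[OF i] id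
  from s show ?thesis
  proof
    assume "s = p \<circ> transpose i (Suc i)"
    then have "s \<circ> transpose i (Suc i) \<circ> inv p = id"
      by (simp add: comp_assoc permutes_inv_o[OF p])
    then have "emd_cost n p s (transpose i (Suc i)) = 2"
      by (simp add: emd_cost_eq_displacement[OF p] disp)
    with adjacent_transpose_permutes[OF i] show ?thesis by (rule that)
  next
    assume "s = transpose i (Suc i) \<circ> p"
    then have "s \<circ> id \<circ> inv p = transpose i (Suc i)"
      by (simp add: comp_assoc permutes_inv_o[OF p])
    then have "emd_cost n p s id = 2"
      by (simp add: emd_cost_eq_displacement[OF p] disp del: comp_id)
    with permutes_id show ?thesis by (rule that)
  qed
qed

lemma relpowp_planar_emd_cost:
  assumes "(planar_simple_transposition n ^^ k) p s"
  shows "\<exists>\<theta>. \<theta> permutes {1..n} \<and> emd_cost n p s \<theta> \<le> 2 * int k"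
  using assms
proof (induction k arbitrary: s)
  case 0
  then show ?case
    by (intro exI[of _ id]) (use permutes_id in \<open>auto simp: emd_cost_def id_def\<close>)
next
  case (Suc k)
  then obtain r where "(planar_simple_transposition n ^^ k) p r"
    and step: "planar_simple_transposition n r s"
    by (auto elim: relpowp_Suc_E)
  then obtain \<theta> where \<theta>: "\<theta> permutes {1..n}" "emd_cost n p r \<theta> \<le> 2 * int k"
    using Suc.IH by blast
  obtain \<eta> where \<eta>: "\<eta> permutes {1..n}" "emd_cost n r s \<eta> = 2"
    using step by (rule planar_simple_transposition_emd_cost)
  have "emd_cost n p s (\<eta> \<circ> \<theta>) \<le> 2 * int (Suc k)"
    using emd_cost_triangle[OF \<theta>(1), of p s \<eta> r] \<theta>(2) \<eta>(2) by simp
  then show ?case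
    using permutes_compose[OF \<theta>(1) \<eta>(1)] by blast
qed

text \<open>The chain passes through \<open>?r\<close>: multiplying on the right by
  \<open>inv \<theta>\<close> is paid for by the horizontal cost, then on the left by
  \<open>?\<beta>\<close> by the vertical cost.\<close>

lemma relpowp_planar_le_emd_cost:
  assumes p1: "p1 permutes {1..n}" and p2: "p2 permutes {1..n}" and \<theta>: "\<theta> permutes {1..n}"
  obtains k where "int k \<le> emd_cost n p1 p2 \<theta>" "(planar_simple_transposition n ^^ k) p1 p2"
proof -
  let ?\<beta> = "p2 \<circ> \<theta> \<circ> inv p1" and ?r = "p1 \<circ> inv \<theta>"
  have r: "?r permutes {1..n}" and \<beta>: "?\<beta> permutes {1..n}"
    using p1 p2 \<theta> by (auto intro: permutes_compose permutes_inv)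
  obtain k where k: "int k \<le> displacement n (inv \<theta>)" "(planar_simple_transposition n ^^ k) p1 ?r"
    using p1 permutes_inv[OF \<theta>] by (rule relpowp_planar_comp_right)
  obtain l where l: "int l \<le> displacement n ?\<beta>" "(planar_simple_transposition n ^^ l) ?r (?\<beta> \<circ> ?r)"
    using r \<beta> by (rule relpowp_planar_comp_left)
  have "?\<beta> \<circ> ?r = p2"
    by (simp add: fun_eq_iff permutes_inverses[OF p1] permutes_inverses[OF \<theta>])
  then have "(planar_simple_transposition n ^^ (k + l)) p1 p2"
    using relpowp_add_I[OF k(2) l(2)] by simp
  moreover have "int (k + l) \<le> emd_cost n p1 p2 \<theta>"
    using k(1) l(1) by (simp add: emd_cost_eq_displacement[OF p1] displacement_inv[OF \<theta>])
  ultimately show ?thesis using that by blast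
qed

theorem corollary1p3:
  fixes n :: nat and p1 p2 :: "nat \<Rightarrow> nat"
  assumes "n \<ge> 1"
    and "p1 permutes {1..n}"
    and "p2 permutes {1..n}"
  shows "planar_tau_dist n p1 p2 \<le> earth_mover_dist n p1 p2 \<and>
         earth_mover_dist n p1 p2 \<le> 2 * planar_tau_dist n p1 p2"
proof -
  let ?costs = "emd_cost n p1 p2 ` {\<theta>. \<theta> permutes {1..n}}"
  have fin: "finite ?costs"
    by (simp add: finite_permutations)
  have "id \<in> {\<theta>. \<theta> permutes {1..n}}"
    by (simp add: permutes_id)
  then have "Min ?costs \<in> ?costs"
    using fin by (intro Min_in) blast+
  then obtain \<theta> where \<theta>: "\<theta> permutes {1..n}" "Min ?costs = emd_cost n p1 p2 \<theta>"
    by blast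
  obtain k where k: "int k \<le> emd_cost n p1 p2 \<theta>" "(planar_simple_transposition n ^^ k) p1 p2"
    using assms(2,3) \<theta>(1) by (rule relpowp_planar_le_emd_cost)
  have "planar_steps n p1 p2 \<le> k"
    unfolding planar_steps_def using k(2) by (rule Least_le)
  then have lower: "real (planar_steps n p1 p2) \<le> real_of_int (Min ?costs)"
    using k(1) \<theta>(2) by linarith
  \<comment> \<open>The chain of length \<open>k\<close> also shows that the \<open>LEAST\<close> is
    attained.\<close>
  have "(planar_simple_transposition n ^^ planar_steps n p1 p2) p1 p2"
    unfolding planar_steps_def using k(2) by (rule LeastI)
  then obtain \<eta> where \<eta>: "\<eta> permutes {1..n}" "emd_cost n p1 p2 \<eta> \<le> 2 * int (planar_steps n p1 p2)"
    using relpowp_planar_emd_cost by blast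
  have "Min ?costs \<le> emd_cost n p1 p2 \<eta>"
    using fin \<eta>(1) by (intro Min_le) auto
  then have upper: "real_of_int (Min ?costs) \<le> 2 * real (planar_steps n p1 p2)"
    using \<eta>(2) by linarith
  show ?thesis
    using lower upper
    by (simp add: planar_tau_dist_def earth_mover_dist_def divide_right_mono)
qed

end
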